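(* Let $p\in(1,\infty)$, let $\mathsf G=(\mathsf V,m,b,c)$ be a connected finite graph with minimal cut weight $\eta_{\mathsf G}$, let $\emptyset\ne\mathsf V_0\subsetneq\mathsf V$, and let $n$ be the number of vertices of $\mathsf V\setminus\mathsf V_0$. Then $$T_p(\mathsf G;\mathsf V_0)\ \le\ \frac{n^{p-1}}{\eta_{\mathsf G}}\,m(\mathsf V\setminus\mathsf V_0)^p .$$ If, additionally, $p=2$ and $m\equiv1$, then the torsional rigidity satisfies the improved estimate $$T_2(\mathsf G;\mathsf V_0)\ \le\ \frac{n(n+1)(2n+1)}{6\,\eta_{\mathsf G}},$$ and equality is attained if and only if $\mathsf G$ is the path graph with Dirichlet conditions at only one endpoint.
   Context: A finite graph $\mathsf G=(\mathsf V,m,b,c)$ consists of a finite set $\mathsf V$, $m:\mathsf V\to(0,\infty)$, a symmetric $b:\mathsf V\times\mathsf V\to[0,\infty)$ with $b(\mathsf v,\mathsf v)=0$, and $c:\mathsf V\to[0,\infty)$. $m(A)=\sum_{\mathsf v\in A}m(\mathsf v)$. Connected: any two vertices are joined by a sequence of vertices whose consecutive members have $b>0$. Path graph: the vertices can be enumerated as $\mathsf v_0,\mathsf v_1,\dots$ so that $b(\mathsf v_i,\mathsf v_j)>0$ if and only if $|i-j|=1$. Minimal cut weight: $\eta_{\mathsf G}=\min\sum_{\mathsf v\in\mathsf V_1,\mathsf w\in\mathsf V_2}b(\mathsf v,\mathsf w)$, minimum over all partitions $\mathsf V=\mathsf V_1\sqcup\mathsf V_2$ into two nonempty sets. $p$-torsional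 rigidity with Dirichlet conditions at $\mathsf V_0$: $$T_p(\mathsf G;\mathsf V_0)=\sup_{0\neq u:\mathsf V\to\mathbb R,\ u|_{\mathsf V_0}=0}\frac{\big(\sum_{\mathsf v}|u(\mathsf v)|m(\mathsf v)\big)^p}{\frac12\sum_{\mathsf v,\mathsf w}b(\mathsf v,\mathsf w)|u(\mathsf v)-u(\mathsf w)|^p+\sum_{\mathsf v}c(\mathsf v)|u(\mathsf v)|^p}.$$ Convention in force: the Dirichlet set $\mathsf V_0$ may without loss of generality be assumed to be a singleton (all vertices of $\mathsf V_0$ are identified, weights of resulting parallel edges being added; this does not change $T_p$).
   Formalization: In the equality case, "the path graph" means: after identifying V_0 to one vertex, G is a path with that vertex as endpoint, all its edge weights equal η_G, and c=0 off V_0; with arbitrary weights or c the "if" fails (weights 1, 2 from the Dirichlet end: T_2 = 4.5 < 5). *)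

theory Defs
  imports Complex_Main "HOL-Library.Extended_Real"
begin

record 'a wgraph =
  verts :: "'a set"
  vmass :: "'a \<Rightarrow> real"
  ewt :: "'a \<Rightarrow> 'a \<Rightarrow> real"
  pot :: "'a \<Rightarrow> real"

definition finite_graph :: "'a wgraph \<Rightarrow> bool" where
  "finite_graph G \<longleftrightarrow>
     finite (verts G) \<and>
     (\<forall>v\<in>verts G. vmass G v > 0) \<and>
     (\<forall>v\<in>verts G. \<forall>w\<in>verts G. ewt G v w \<ge> 0 \<and> ewt G v w = ewt G w v) \<and>
     (\<forall>v\<in>verts G. ewt G v v = 0) \<and>
     (\<forall>v\<in>verts G. pot G v \<ge> 0)"

definition total_mass :: "'a wgraph \<Rightarrow> 'a set \<Rightarrow> real" where
  "total_mass G A = (\<Sum>v\<in>A. vmass G v)"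

definition connected_graph :: "'a wgraph \<Rightarrow> bool" where
  "connected_graph G \<longleftrightarrow>
     (\<forall>v\<in>verts G. \<forall>w\<in>verts G. \<exists>xs. xs \<noteq> [] \<and> set xs \<subseteq> verts G \<and>
        hd xs = v \<and> last xs = w \<and> successively (\<lambda>x y. ewt G x y > 0) xs)"

definition min_cut :: "'a wgraph \<Rightarrow> real" where
  "min_cut G = Min {\<Sum>v\<in>V1. \<Sum>w\<in>V2. ewt G v w | V1 V2.
     V1 \<union> V2 = verts G \<and> V1 \<inter> V2 = {} \<and> V1 \<noteq> {} \<and> V2 \<noteq> {}}"

definition energy :: "real \<Rightarrow> 'a wgraph \<Rightarrow> ('a \<Rightarrow> real) \<Rightarrow> real" where
  "energy p G u =
     1 / 2 * (\<Sum>v\<in>verts G. \<Sum>w\<in>verts G. ewt G v w * \<bar>u v - u w\<bar> powr p)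
     + (\<Sum>v\<in>verts G. pot G v * \<bar>u v\<bar> powr p)"

text \<open>The supremum is taken in the extended reals, so that an upper bound on it
  includes boundedness of the set of quotients.\<close>

definition torsional_rigidity :: "real \<Rightarrow> 'a wgraph \<Rightarrow> 'a set \<Rightarrow> ereal" where
  "torsional_rigidity p G V0 =
     (SUP u\<in>{u. (\<forall>v\<in>V0. u v = 0) \<and> (\<exists>v\<in>verts G. u v \<noteq> 0)}.
        ereal ((\<Sum>v\<in>verts G. \<bar>u v\<bar> * vmass G v) powr p) / ereal (energy p G u))"

definition path_enumeration :: "'a wgraph \<Rightarrow> (nat \<Rightarrow> 'a) \<Rightarrow> bool" where
  "path_enumeration G e \<longleftrightarrow>
     bij_betw e {..<card (verts G)} (verts G) \<and>
     (\<forall>i<card (verts G). \<forall>j<card (verts G).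
        ewt G (e i) (e j) > 0 \<longleftrightarrow> \<bar>int i - int j\<bar> = 1)"

text \<open>Identification of all vertices of \<open>V0\<close> to the single vertex \<open>None\<close>; the weights of
  resulting parallel edges are added, edges inside \<open>V0\<close> disappear.\<close>

definition identify :: "'a wgraph \<Rightarrow> 'a set \<Rightarrow> 'a option wgraph" where
  "identify G V0 =
     \<lparr> verts = insert None (Some ` (verts G - V0)),
       vmass = case_option (\<Sum>v\<in>V0. vmass G v) (vmass G),
       ewt = (\<lambda>x y. case x of
            None \<Rightarrow> (case y of None \<Rightarrow> 0 | Some w \<Rightarrow> (\<Sum>v\<in>V0. ewt G v w))
          | Some v \<Rightarrow> (case y of None \<Rightarrow> (\<Sum>w\<in>V0. ewt G v w) | Some w \<Rightarrow> ewt G v w)),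
       pot = case_option (\<Sum>v\<in>V0. pot G v) (pot G) \<rparr>"

text \<open>After identification the graph is a path and the Dirichlet vertex is an endpoint of it.
  Reversing the enumeration shows that it is no restriction to take the endpoint \<open>e 0\<close>.\<close>

definition dirichlet_path :: "'a wgraph \<Rightarrow> 'a set \<Rightarrow> bool" where
  "dirichlet_path G V0 \<longleftrightarrow> (\<exists>e. path_enumeration (identify G V0) e \<and> e 0 = None)"

lemma dirichlet_path_singleton:
  assumes fin: "finite_graph G" and z: "z \<in> verts G"
  shows "dirichlet_path G {z} \<longleftrightarrow> (\<exists>e. path_enumeration G e \<and> e 0 = z)"
proof -
  let ?H = "identify G {z}"
  define f where "f = (\<lambda>x. case x of None \<Rightarrow> z | Some v \<Rightarrow> v)"
  define g where "g = (\<lambda>v. if v = z then None else Some v)"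
  have f: "bij_betw f (verts ?H) (verts G)"
    using z by (auto simp: bij_betw_def inj_on_def identify_def f_def image_iff split: option.splits)
  have g: "bij_betw g (verts G) (verts ?H)"
    using z by (auto simp: bij_betw_def inj_on_def identify_def g_def image_iff split: if_splits)
  have card: "card (verts ?H) = card (verts G)"
    using bij_betw_same_card[OF f] .
  have wt: "ewt G (f x) (f y) = ewt ?H x y" for x y
    using fin z by (auto simp: identify_def f_def finite_graph_def split: option.splits)
  have wt': "ewt ?H (g x) (g y) = ewt G x y" for x y
    using fin z by (auto simp: identify_def g_def finite_graph_def)
  show ?thesis
  proof
    assume "dirichlet_path G {z}"
    then obtain e where e: "path_enumeration ?H e" "e 0 = None"
      by (auto simp: dirichlet_path_def)
    have "path_enumeration G (f \<circ> e)"
      using e f bij_betw_trans[of e _ _ f] by (auto simp: path_enumeration_def card wt)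
    moreover have "(f \<circ> e) 0 = z" using e by (simp add: f_def)
    ultimately show "\<exists>e. path_enumeration G e \<and> e 0 = z" by blast
  next
    assume "\<exists>e. path_enumeration G e \<and> e 0 = z"
    then obtain e where e: "path_enumeration G e" "e 0 = z" by blast
    have "path_enumeration ?H (g \<circ> e)"
      using e g bij_betw_trans[of e _ _ g] by (auto simp: path_enumeration_def card wt')
    moreover have "(g \<circ> e) 0 = None" using e by (simp add: g_def)
    ultimately show "dirichlet_path G {z}" by (auto simp: dirichlet_path_def)
  qed
qed

end

theory Submission
  imports Defs "HOL-Analysis.Convex" "HOL-Analysis.Function_Topology"
begin

text \<open>
  Replacing a test function by its absolute value does not increase the energy, so it may be taken
  nonnegative. Sort its values as \<open>0 = a 0 \<le> a 1 \<le> \<dots> \<le> a n\<close>, the Dirichlet vertices having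
  rank \<open>0\<close>. An edge between ranks \<open>i < j\<close> contributes
  \<open>(a j - a i) powr p \<ge> (\<Sum>k\<in>{i..<j}. (a (Suc k) - a k) powr p)\<close>, and summing over the edges
  crossing the level between \<open>k\<close> and \<open>Suc k\<close> produces the weight of a cut, which is at least the
  minimal cut weight. The bounds then follow from the inequality of power means and, for \<open>p = 2\<close>,
  \<open>m = 1\<close>, from Cauchy--Schwarz against the numbers \<open>n - k\<close> of vertices above level \<open>k\<close>.

  If the second bound is attained, an extremal function exists by compactness and all these
  inequalities are tight: the increments are proportional to \<open>n - k\<close>, hence positive, so no edge
  skips a rank, every level cut is minimal and the potential vanishes.
\<close>

section \<open>Inequalities for finite sums\<close>

lemma powr_eq_mult_powr:
  fixes x :: real
  assumes "0 \<le> x"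
  shows "x powr p = x * x powr (p - 1)"
  using powr_mult_base[OF assms, of "p - 1"] by simp

text \<open>Superadditivity of the power: one factor of each \<open>d k powr p\<close> is kept, and
  its remaining power \<open>p - 1\<close> is bounded by that of the total, which dominates every
  term.\<close>

lemma sum_powr_le_powr_sum:
  fixes d :: "'b \<Rightarrow> real"
  assumes "finite A" "1 \<le> p" and nonneg: "\<And>k. k \<in> A \<Longrightarrow> 0 \<le> d k"
  shows "(\<Sum>k\<in>A. d k powr p) \<le> (\<Sum>k\<in>A. d k) powr p"
proof -
  have "(\<Sum>k\<in>A. d k powr p) = (\<Sum>k\<in>A. d k * d k powr (p - 1))"
    by (intro sum.cong refl powr_eq_mult_powr nonneg)
  also have "\<dots> \<le> (\<Sum>k\<in>A. d k * (\<Sum>k\<in>A. d k) powr (p - 1))"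
    using assms by (intro sum_mono mult_left_mono powr_mono2 member_le_sum) auto
  also have "\<dots> = (\<Sum>k\<in>A. d k) powr p"
    using powr_eq_mult_powr[of "\<Sum>k\<in>A. d k" p] nonneg by (simp add: sum_distrib_right sum_nonneg)
  finally show ?thesis .
qed

text \<open>As soon as there are two positive terms, each one is strictly below the total, so for
  \<open>p > 1\<close> the comparison of the powers \<open>p - 1\<close> is strict.\<close>

lemma sum_powr_less_powr_sum:
  fixes d :: "'b \<Rightarrow> real"
  assumes "finite A" "1 < p" and pos: "\<And>k. k \<in> A \<Longrightarrow> 0 < d k"
    and ij: "i \<in> A" "j \<in> A" "i \<noteq> j"
  shows "(\<Sum>k\<in>A. d k powr p) < (\<Sum>k\<in>A. d k) powr p"
proof -
  have nonneg: "0 \<le> d k" if "k \<in> A" for k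
    using pos[OF that] by simp
  have less: "d k < (\<Sum>k\<in>A. d k)" if k: "k \<in> A" for k
  proof -
    obtain l where l: "l \<in> A" "l \<noteq> k" using ij by metis
    have "d k < d k + d l" using pos l by simp
    also have "\<dots> = (\<Sum>i\<in>{k, l}. d i)" using l by simp
    also have "\<dots> \<le> (\<Sum>k\<in>A. d k)"
      using k l assms(1) nonneg by (intro sum_mono2) auto
    finally show ?thesis .
  qed
  have "(\<Sum>k\<in>A. d k powr p) = (\<Sum>k\<in>A. d k * d k powr (p - 1))"
    by (intro sum.cong refl powr_eq_mult_powr nonneg)
  also have "\<dots> < (\<Sum>k\<in>A. d k * (\<Sum>k\<in>A. d k) powr (p - 1))"
    using assms less nonneg
    by (intro sum_strict_mono mult_strict_left_mono powr_less_mono2) auto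
  also have "\<dots> = (\<Sum>k\<in>A. d k) powr p"
    using powr_eq_mult_powr[of "\<Sum>k\<in>A. d k" p] nonneg by (simp add: sum_distrib_right sum_nonneg)
  finally show ?thesis .
qed

text \<open>Jensen's inequality for the convex power with equal weights, that is, the inequality of
  power means.\<close>

lemma powr_sum_le_card_powr:
  fixes d :: "'b \<Rightarrow> real"
  assumes "finite A" "1 \<le> p" and nonneg: "\<And>k. k \<in> A \<Longrightarrow> 0 \<le> d k"
  shows "(\<Sum>k\<in>A. d k) powr p \<le> real (card A) powr (p - 1) * (\<Sum>k\<in>A. d k powr p)"
proof -
  \<comment> \<open>Jensen is applied to the positive terms only. Zero terms change neither sum, and
    \<open>card B \<le> card A\<close> restores the stated constant at the end.\<close>
  define B where "B = {k \<in> A. 0 < d k}"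
  have B: "finite B" "B \<subseteq> A" using assms(1) by (auto simp: B_def)
  have sum_B: "(\<Sum>k\<in>A. d k) = (\<Sum>k\<in>B. d k)" "(\<Sum>k\<in>A. d k powr p) = (\<Sum>k\<in>B. d k powr p)"
    using assms(1) nonneg by (auto simp: B_def less_le intro!: sum.mono_neutral_right)
  show ?thesis
  proof (cases "B = {}")
    case True
    then show ?thesis by (simp add: sum_B)
  next
    case False
    define N where "N = real (card B)"
    have N: "0 < N" using False B by (simp add: N_def card_gt_0_iff)
    have "(\<Sum>k\<in>B. (1 / N) *\<^sub>R d k) powr p \<le> (\<Sum>k\<in>B. (1 / N) * d k powr p)"
      using False B N
      by (intro convex_on_sum[OF _ _ powr_convex[OF assms(2)]]) (auto simp: N_def B_def)
    then have "((\<Sum>k\<in>B. d k) / N) powr p \<le> (\<Sum>k\<in>B. d k powr p) / N"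
      by (simp add: sum_divide_distrib)
    moreover have "((\<Sum>k\<in>B. d k) / N) powr p = (\<Sum>k\<in>B. d k) powr p / N powr p"
      using N nonneg B by (subst powr_divide) (auto intro!: sum_nonneg)
    moreover have "N powr p = N * N powr (p - 1)" using N by (intro powr_eq_mult_powr) simp
    ultimately have "(\<Sum>k\<in>B. d k) powr p \<le> N powr (p - 1) * (\<Sum>k\<in>B. d k powr p)"
      using N by (simp add: field_simps)
    also have "\<dots> \<le> real (card A) powr (p - 1) * (\<Sum>k\<in>B. d k powr p)"
      using assms B by (intro mult_right_mono powr_mono2 sum_nonneg) (auto simp: N_def card_mono)
    finally show ?thesis by (simp add: sum_B)
  qed
qed

text \<open>The gap in the Cauchy--Schwarz inequality written as a sum of squares. If the gap
  vanishes and \<open>S\<close> is nonzero, then \<open>d\<close> is the multiple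
  \<open>P / S\<close> of \<open>M\<close>.\<close>

lemma Cauchy_Schwarz_sum_defect:
  fixes d M :: "'b \<Rightarrow> real" and A :: "'b set"
  defines "P \<equiv> \<Sum>k\<in>A. d k * M k" and "S \<equiv> \<Sum>k\<in>A. (M k)\<^sup>2"
  shows "(\<Sum>k\<in>A. (S * d k - P * M k)\<^sup>2) = S * (S * (\<Sum>k\<in>A. (d k)\<^sup>2) - P\<^sup>2)"
proof -
  have "(\<Sum>k\<in>A. (S * d k - P * M k)\<^sup>2)
      = (\<Sum>k\<in>A. S\<^sup>2 * (d k)\<^sup>2 - 2 * S * P * (d k * M k) + P\<^sup>2 * (M k)\<^sup>2)"
    by (intro sum.cong) (auto simp: power2_eq_square algebra_simps)
  also have "\<dots> = S\<^sup>2 * (\<Sum>k\<in>A. (d k)\<^sup>2) - 2 * S * P * P + P\<^sup>2 * S"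
    by (simp add: sum.distrib sum_subtractf sum_distrib_left P_def S_def)
  also have "\<dots> = S * (S * (\<Sum>k\<in>A. (d k)\<^sup>2) - P\<^sup>2)"
    by (simp add: power2_eq_square algebra_simps)
  finally show ?thesis .
qed

lemma sum_squares_descending:
  "(\<Sum>k<n. (real n - real k)\<^sup>2) = real n * (real n + 1) * (2 * real n + 1) / 6"
proof -
  \<comment> \<open>For \<open>k < n\<close> the difference \<open>n - k\<close> equals
    \<open>Suc (n - Suc k)\<close>, the shape in which the order of summation can be
    reversed.\<close>
  have "(\<Sum>k<n. (real n - real k)\<^sup>2) = (\<Sum>k<n. (real (Suc (n - Suc k)))\<^sup>2)"
    by (intro sum.cong) (auto simp: of_nat_diff)
  also have "\<dots> = (\<Sum>k<n. (real (Suc k))\<^sup>2)"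
    by (rule sum.nat_diff_reindex)
  also have "\<dots> = real n * (real n + 1) * (2 * real n + 1) / 6"
    by (induction n) (auto simp: power2_eq_square field_simps)
  finally show ?thesis .
qed

section \<open>Cuts\<close>

lemma finite_cut_values:
  assumes "finite V"
  shows "finite {\<Sum>v\<in>V1. \<Sum>w\<in>V2. f v w | V1 V2.
     V1 \<union> V2 = V \<and> V1 \<inter> V2 = {} \<and> V1 \<noteq> {} \<and> V2 \<noteq> {}}"
proof (rule finite_subset)
  show "{\<Sum>v\<in>V1. \<Sum>w\<in>V2. f v w | V1 V2. V1 \<union> V2 = V \<and> V1 \<inter> V2 = {} \<and> V1 \<noteq> {} \<and> V2 \<noteq> {}}
     \<subseteq> (\<lambda>(V1, V2). \<Sum>v\<in>V1. \<Sum>w\<in>V2. f v w) ` (Pow V \<times> Pow V)"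
    by auto
qed (use assms in auto)

lemma min_cut_le:
  assumes "finite_graph G" "V1 \<union> V2 = verts G" "V1 \<inter> V2 = {}" "V1 \<noteq> {}" "V2 \<noteq> {}"
  shows "min_cut G \<le> (\<Sum>v\<in>V1. \<Sum>w\<in>V2. ewt G v w)"
  unfolding min_cut_def using assms
  by (intro Min_le finite_cut_values) (auto simp: finite_graph_def)

text \<open>The first step at which the list leaves \<open>A\<close> is the required pair.\<close>

lemma successively_crossing:
  assumes "successively P xs" "xs \<noteq> []" "hd xs \<in> A" "last xs \<notin> A"
  shows "\<exists>x\<in>set xs. \<exists>y\<in>set xs. x \<in> A \<and> y \<notin> A \<and> P x y"
  using assms
proof (induction xs)
  case (Cons x xs)
  show ?case
  proof (cases "xs \<noteq> [] \<and> hd xs \<in> A")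
    case True
    then show ?thesis using Cons by (auto simp: successively_Cons)
  next
    case False
    then have "xs \<noteq> []" "hd xs \<notin> A" using Cons.prems by auto
    then show ?thesis using Cons.prems by (auto simp: successively_Cons intro!: bexI[of _ "hd xs"])
  qed
qed simp

text \<open>A walk from one side of a cut to the other uses a crossing edge of positive weight, so
  each of the finitely many cut values is positive.\<close>

lemma min_cut_pos:
  assumes G: "finite_graph G" "connected_graph G"
    and V0: "V0 \<noteq> {}" "V0 \<subset> verts G"
  shows "0 < min_cut G"
proof -
  have fin: "finite (verts G)" using G by (simp add: finite_graph_def)
  have "0 < (\<Sum>v\<in>V1. \<Sum>w\<in>V2. ewt G v w)"
    if V: "V1 \<union> V2 = verts G" "V1 \<inter> V2 = {}" "V1 \<noteq> {}" "V2 \<noteq> {}" for V1 V2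
  proof -
    obtain v w where vw: "v \<in> V1" "w \<in> V2" using V by auto
    then obtain xs where xs: "xs \<noteq> []" "set xs \<subseteq> verts G" "hd xs = v" "last xs = w"
      "successively (\<lambda>x y. ewt G x y > 0) xs"
      using G V unfolding connected_graph_def by blast
    have "last xs \<notin> V1" using vw V xs by auto
    then obtain x y where xy: "x \<in> set xs" "y \<in> set xs" "x \<in> V1" "y \<notin> V1" "ewt G x y > 0"
      using successively_crossing[OF xs(5,1), of V1] xs vw by auto
    have y: "y \<in> V2" using xy xs V by auto
    have fin12: "finite V1" "finite V2" using fin V by (auto intro: finite_subset)
    have nonneg: "0 \<le> ewt G v w" if "v \<in> V1" "w \<in> V2" for v w
      using G V that unfolding finite_graph_def by blast
    have "0 < (\<Sum>w\<in>V2. ewt G x w)"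
      using xy y fin12 nonneg by (intro sum_pos2[of _ y]) auto
    then show ?thesis
      using xy fin12 nonneg by (intro sum_pos2[of V1 x "\<lambda>v. \<Sum>w\<in>V2. ewt G v w"] sum_nonneg)
  qed
  \<comment> \<open>\<open>Min\<close> is meaningful only on a nonempty set; \<open>V0\<close> and
    its complement provide one cut.\<close>
  moreover have "\<exists>V1 V2. V1 \<union> V2 = verts G \<and> V1 \<inter> V2 = {} \<and> V1 \<noteq> {} \<and> V2 \<noteq> {}"
  proof (intro exI conjI)
    show "V0 \<union> (verts G - V0) = verts G" "V0 \<inter> (verts G - V0) = {}" using V0 by auto
    show "V0 \<noteq> {}" "verts G - V0 \<noteq> {}" using V0 by auto
  qed
  ultimately show ?thesis
    unfolding min_cut_def by (subst Min_gr_iff[OF finite_cut_values[OF fin]]) blast+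
qed

section \<open>Ranked vertices\<close>

text \<open>All Dirichlet vertices share rank 0 and the others receive the ranks \<open>1\<close> to
  \<open>n\<close> bijectively. Thus \<open>V0\<close> acts as one vertex while the calculations
  stay in \<open>G\<close> itself.\<close>

locale vertex_ranking =
  fixes G :: "'a wgraph" and V0 :: "'a set" and n :: nat and r :: "'a \<Rightarrow> nat"
  assumes graph: "finite_graph G"
    and V0: "V0 \<noteq> {}" "V0 \<subseteq> verts G"
    and rank_V0: "v \<in> V0 \<Longrightarrow> r v = 0"
    and bij_rank: "bij_betw r (verts G - V0) {1..n}"
begin

text \<open>The index \<open>k\<close> denotes the gap between the ranks \<open>k\<close> and
  \<open>Suc k\<close>. The set \<open>V0\<close> is always on the lower side, and the upper side is
  nonempty exactly for \<open>k < n\<close>.\<close>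

definition level_cut :: "nat \<Rightarrow> real" where
  "level_cut k = (\<Sum>v\<in>{v \<in> verts G. r v \<le> k}. \<Sum>w\<in>{w \<in> verts G. k < r w}. ewt G v w)"

lemma finite_verts: "finite (verts G)"
  using graph by (simp add: finite_graph_def)

lemma ewt_nonneg: "v \<in> verts G \<Longrightarrow> w \<in> verts G \<Longrightarrow> 0 \<le> ewt G v w"
  using graph by (simp add: finite_graph_def)

lemma ewt_sym: "v \<in> verts G \<Longrightarrow> w \<in> verts G \<Longrightarrow> ewt G v w = ewt G w v"
  using graph by (simp add: finite_graph_def)

lemma pot_nonneg: "v \<in> verts G \<Longrightarrow> 0 \<le> pot G v"
  using graph by (simp add: finite_graph_def)

lemma rank_in: "v \<in> verts G - V0 \<Longrightarrow> r v \<in> {1..n}"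
  using bij_rank by (auto simp: bij_betw_def)

lemma rank_le: "v \<in> verts G \<Longrightarrow> r v \<le> n"
  using rank_in[of v] rank_V0[of v] by (cases "v \<in> V0") auto

lemma rank_eq_0_iff: "v \<in> verts G \<Longrightarrow> r v = 0 \<longleftrightarrow> v \<in> V0"
  using rank_in[of v] rank_V0[of v] by fastforce

lemma rank_surj:
  assumes "i \<le> n"
  shows "\<exists>v\<in>verts G. r v = i"
proof (cases "i = 0")
  case True
  then show ?thesis using V0 rank_V0 by blast
next
  case False
  then have "i \<in> r ` (verts G - V0)"
    using assms bij_rank by (simp add: bij_betw_def)
  then show ?thesis by auto
qed

lemma min_cut_le_level_cut:
  assumes "k < n"
  shows "min_cut G \<le> level_cut k"
  unfolding level_cut_def
  using rank_surj[of 0] rank_surj[of n] assms by (intro min_cut_le[OF graph]) auto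

text \<open>An edge crosses level \<open>k\<close> exactly if \<open>k\<close> lies in the half-open
  interval between its ranks. The symmetric double sum meets each such edge in both orders, whence
  the factor one half, as in the energy.\<close>

lemma level_cut_eq_half_sum:
  "1 / 2 * (\<Sum>v\<in>verts G. \<Sum>w\<in>verts G.
      ewt G v w * of_bool (k \<in> {min (r v) (r w)..<max (r v) (r w)})) = level_cut k"
proof -
  let ?V = "verts G"
  have cut: "(\<Sum>v\<in>?V. \<Sum>w\<in>?V. ewt G v w * of_bool (r v \<le> k \<and> k < r w)) = level_cut k"
  proof -
    have "level_cut k = (\<Sum>v\<in>?V. if r v \<le> k then \<Sum>w\<in>?V. if k < r w then ewt G v w else 0 else 0)"
      unfolding level_cut_def using finite_verts by (simp add: sum.inter_filter)
    also have "\<dots> = (\<Sum>v\<in>?V. \<Sum>w\<in>?V. ewt G v w * of_bool (r v \<le> k \<and> k < r w))"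
      by (intro sum.cong refl) (auto intro!: sum.cong sum.neutral[symmetric])
    finally show ?thesis ..
  qed
  have "(\<Sum>v\<in>?V. \<Sum>w\<in>?V. ewt G v w * of_bool (r w \<le> k \<and> k < r v))
      = (\<Sum>w\<in>?V. \<Sum>v\<in>?V. ewt G v w * of_bool (r w \<le> k \<and> k < r v))"
    by (rule sum.swap)
  also have "\<dots> = (\<Sum>v\<in>?V. \<Sum>w\<in>?V. ewt G v w * of_bool (r v \<le> k \<and> k < r w))"
    by (intro sum.cong refl) (simp add: ewt_sym)
  finally have cut': "(\<Sum>v\<in>?V. \<Sum>w\<in>?V. ewt G v w * of_bool (r w \<le> k \<and> k < r v)) = level_cut k"
    using cut by simp
  have "(\<Sum>v\<in>?V. \<Sum>w\<in>?V. ewt G v w * of_bool (k \<in> {min (r v) (r w)..<max (r v) (r w)}))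
      = (\<Sum>v\<in>?V. \<Sum>w\<in>?V. ewt G v w * of_bool (r v \<le> k \<and> k < r w)
          + ewt G v w * of_bool (r w \<le> k \<and> k < r v))"
    by (intro sum.cong refl) (auto simp: min_def max_def)
  also have "\<dots> = 2 * level_cut k"
    by (simp add: sum.distrib cut cut')
  finally show ?thesis by simp
qed

text \<open>If no edge skips a rank, an edge across level \<open>k\<close> can only start at rank
  \<open>k\<close> and end at rank \<open>Suc k\<close>.\<close>

lemma level_cut_eq_consecutive:
  assumes no_skip: "\<And>v w. v \<in> verts G \<Longrightarrow> w \<in> verts G \<Longrightarrow> r v + 2 \<le> r w \<Longrightarrow> ewt G v w = 0"
  shows "level_cut k = (\<Sum>v\<in>{v \<in> verts G. r v = k}. \<Sum>w\<in>{w \<in> verts G. r w = Suc k}. ewt G v w)"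
proof -
  have inner: "(\<Sum>w\<in>{w \<in> verts G. k < r w}. ewt G v w) = (\<Sum>w\<in>{w \<in> verts G. r w = Suc k}. ewt G v w)"
    if "v \<in> verts G" "r v \<le> k" for v
    using finite_verts that by (intro sum.mono_neutral_right) (auto intro!: no_skip)
  have "level_cut k = (\<Sum>v\<in>{v \<in> verts G. r v \<le> k}. \<Sum>w\<in>{w \<in> verts G. r w = Suc k}. ewt G v w)"
    unfolding level_cut_def by (rule sum.cong) (auto simp: inner)
  also have "\<dots> = (\<Sum>v\<in>{v \<in> verts G. r v = k}. \<Sum>w\<in>{w \<in> verts G. r w = Suc k}. ewt G v w)"
    using finite_verts by (intro sum.mono_neutral_right) (auto intro!: sum.neutral no_skip)
  finally show ?thesis .
qed

end

section \<open>Layer decomposition of monotone functions of the rank\<close>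

locale ranked_function = vertex_ranking +
  fixes a :: "nat \<Rightarrow> real"
  assumes a_0: "a 0 = 0"
    and a_mono: "k < n \<Longrightarrow> a k \<le> a (Suc k)"
begin

definition incr :: "nat \<Rightarrow> real" where
  "incr k = a (Suc k) - a k"

text \<open>The loss incurred when the power of a difference is replaced by the sum of the powers of
  the increments in between. Naming it allows the layer decomposition of the energy to be an
  identity.\<close>

definition excess :: "real \<Rightarrow> nat \<Rightarrow> nat \<Rightarrow> real" where
  "excess p i j = \<bar>a i - a j\<bar> powr p - (\<Sum>k\<in>{min i j..<max i j}. incr k powr p)"

lemma incr_nonneg: "k < n \<Longrightarrow> 0 \<le> incr k"
  using a_mono by (simp add: incr_def)

lemma a_eq_sum_incr: "a i = (\<Sum>k<i. incr k)"
  by (simp add: incr_def sum_lessThan_telescope a_0)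

lemma a_nonneg: "i \<le> n \<Longrightarrow> 0 \<le> a i"
  by (auto simp: a_eq_sum_incr intro!: sum_nonneg incr_nonneg)

lemma abs_diff_eq_sum_incr:
  assumes "i \<le> n" "j \<le> n"
  shows "\<bar>a i - a j\<bar> = (\<Sum>k\<in>{min i j..<max i j}. incr k)"
proof -
  have *: "a j - a i = (\<Sum>k\<in>{i..<j}. incr k)" if "i \<le> j" for i j
    using that by (simp add: incr_def sum_Suc_diff')
  have nonneg: "0 \<le> (\<Sum>k\<in>{i..<j}. incr k)" if "j \<le> n" for i j
    using that by (auto intro!: sum_nonneg incr_nonneg)
  show ?thesis
    using *[of i j] *[of j i] nonneg[of i j] nonneg[of j i] assms
    by (cases "i \<le> j") (auto simp: min_def max_def)
qed

lemma excess_nonneg: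
  assumes "1 \<le> p" "i \<le> n" "j \<le> n"
  shows "0 \<le> excess p i j"
  unfolding excess_def abs_diff_eq_sum_incr[OF assms(2,3)]
  using assms by (auto intro!: sum_powr_le_powr_sum incr_nonneg)

text \<open>The condition \<open>i + 2 \<le> j\<close> places at least the two positive increments
  \<open>i\<close> and \<open>Suc i\<close> between the ranks, so superadditivity is strict.\<close>

lemma excess_pos:
  assumes "1 < p" "j \<le> n" "i + 2 \<le> j" "\<And>k. k < n \<Longrightarrow> 0 < incr k"
  shows "0 < excess p i j"
proof -
  have "(\<Sum>k\<in>{i..<j}. incr k powr p) < (\<Sum>k\<in>{i..<j}. incr k) powr p"
    using assms by (intro sum_powr_less_powr_sum[of _ _ _ i "Suc i"]) auto
  then show ?thesis
    using assms abs_diff_eq_sum_incr[of i j] by (simp add: excess_def min_def max_def)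
qed

lemma excess_eq_0:
  assumes "i \<le> n" "j \<le> n" "i \<le> Suc j" "j \<le> Suc i"
  shows "excess p i j = 0"
proof -
  consider "i = j" | "j = Suc i" | "i = Suc j" using assms by linarith
  then show ?thesis
    using assms by cases (simp_all add: excess_def abs_diff_eq_sum_incr min_def max_def)
qed

text \<open>Exchange the sum over levels with the sum over pairs of vertices. The bracket collects
  what the lower bound discards; it is nonnegative for \<open>p \<ge> 1\<close>, and keeping it
  explicit serves the equality case.\<close>

lemma energy_eq_layers:
  "energy p G (\<lambda>v. a (r v))
   = (\<Sum>k<n. incr k powr p * level_cut k)
     + (1 / 2 * (\<Sum>v\<in>verts G. \<Sum>w\<in>verts G. ewt G v w * excess p (r v) (r w))
     + (\<Sum>v\<in>verts G. pot G v * a (r v) powr p))"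
proof -
  let ?V = "verts G"
  define I where "I v w = {min (r v) (r w)..<max (r v) (r w)}" for v w
  have "(\<Sum>k<n. incr k powr p * level_cut k)
      = (\<Sum>k<n. 1 / 2 * (\<Sum>v\<in>?V. \<Sum>w\<in>?V. ewt G v w * (of_bool (k \<in> I v w) * incr k powr p)))"
    unfolding I_def by (simp add: level_cut_eq_half_sum[symmetric] sum_distrib_left mult_ac)
  also have "\<dots> = 1 / 2 * (\<Sum>v\<in>?V. \<Sum>w\<in>?V. \<Sum>k<n. ewt G v w * (of_bool (k \<in> I v w) * incr k powr p))"
    unfolding sum_distrib_left[symmetric]
    by (simp only: sum.swap[of _ ?V "{..<n}"] sum_distrib_left)
  also have "\<dots> = 1 / 2 * (\<Sum>v\<in>?V. \<Sum>w\<in>?V. ewt G v w * (\<Sum>k\<in>I v w. incr k powr p))"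
  proof -
    have "(\<Sum>k<n. ewt G v w * (of_bool (k \<in> I v w) * incr k powr p))
        = ewt G v w * (\<Sum>k\<in>I v w. incr k powr p)" if "v \<in> ?V" "w \<in> ?V" for v w
    proof -
      have "I v w \<subseteq> {..<n}" using rank_le[of v] rank_le[of w] that by (auto simp: I_def)
      then have "(\<Sum>k\<in>I v w. incr k powr p) = (\<Sum>k<n. of_bool (k \<in> I v w) * incr k powr p)"
        by (intro sum.mono_neutral_cong_left) auto
      then show ?thesis by (simp only: sum_distrib_left)
    qed
    then show ?thesis by (auto intro!: sum.cong)
  qed
  finally have layers: "(\<Sum>k<n. incr k powr p * level_cut k)
      = 1 / 2 * (\<Sum>v\<in>?V. \<Sum>w\<in>?V. ewt G v w * (\<Sum>k\<in>I v w. incr k powr p))" .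
  have "(\<Sum>v\<in>?V. pot G v * \<bar>a (r v)\<bar> powr p) = (\<Sum>v\<in>?V. pot G v * a (r v) powr p)"
    using a_nonneg rank_le by (auto intro!: sum.cong)
  then show ?thesis
    unfolding energy_def layers excess_def I_def
    by (simp add: right_diff_distrib sum_subtractf)
qed

lemma layers_le_energy:
  assumes "1 \<le> p"
  shows "min_cut G * (\<Sum>k<n. incr k powr p) \<le> energy p G (\<lambda>v. a (r v))"
proof -
  have "min_cut G * (\<Sum>k<n. incr k powr p) \<le> (\<Sum>k<n. incr k powr p * level_cut k)"
    unfolding sum_distrib_left using min_cut_le_level_cut
    by (intro sum_mono) (simp add: mult.commute mult_right_mono)
  moreover have "0 \<le> (\<Sum>v\<in>verts G. \<Sum>w\<in>verts G. ewt G v w * excess p (r v) (r w))"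
    using assms by (auto intro!: sum_nonneg mult_nonneg_nonneg ewt_nonneg excess_nonneg rank_le)
  moreover have "0 \<le> (\<Sum>v\<in>verts G. pot G v * a (r v) powr p)"
    using pot_nonneg by (auto intro!: sum_nonneg)
  ultimately show ?thesis unfolding energy_eq_layers by simp
qed

text \<open>Layer-cake summation: \<open>a (r v)\<close> is the sum of the increments below the rank
  of \<open>v\<close>, and the order of summation is exchanged.\<close>

lemma sum_function_eq_layers:
  "(\<Sum>v\<in>verts G. a (r v) * m v) = (\<Sum>k<n. incr k * (\<Sum>v\<in>{v \<in> verts G. k < r v}. m v))"
proof -
  have "(\<Sum>v\<in>verts G. a (r v) * m v)
      = (\<Sum>v\<in>verts G. \<Sum>k<n. if k < r v then incr k * m v else 0)"
  proof (intro sum.cong refl)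
    fix v assume v: "v \<in> verts G"
    have "(\<Sum>k<n. if k < r v then incr k * m v else 0) = (\<Sum>k<r v. incr k * m v)"
      using rank_le[OF v] by (intro sum.mono_neutral_cong_right) auto
    then show "a (r v) * m v = (\<Sum>k<n. if k < r v then incr k * m v else 0)"
      by (simp add: a_eq_sum_incr sum_distrib_right)
  qed
  also have "\<dots> = (\<Sum>k<n. \<Sum>v\<in>verts G. if k < r v then incr k * m v else 0)"
    by (rule sum.swap)
  also have "\<dots> = (\<Sum>k<n. incr k * (\<Sum>v\<in>{v \<in> verts G. k < r v}. m v))"
    using finite_verts by (simp add: sum.inter_filter[symmetric] sum_distrib_left)
  finally show ?thesis .
qed

lemma card_above_level:
  "k < n \<Longrightarrow> card {v \<in> verts G. k < r v} = n - k"
proof -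
  assume k: "k < n"
  have "bij_betw r {v \<in> verts G. k < r v} {Suc k..n}"
  proof (rule bij_betw_subset[OF bij_rank, of "{v \<in> verts G. k < r v}" "{Suc k..n}"])
    show "{v \<in> verts G. k < r v} \<subseteq> verts G - V0" using rank_V0 by auto
    show "r ` {v \<in> verts G. k < r v} = {Suc k..n}"
    proof
      show "r ` {v \<in> verts G. k < r v} \<subseteq> {Suc k..n}" using rank_le by auto
      show "{Suc k..n} \<subseteq> r ` {v \<in> verts G. k < r v}"
      proof
        fix i assume "i \<in> {Suc k..n}"
        then show "i \<in> r ` {v \<in> verts G. k < r v}" using rank_surj[of i] by force
      qed
    qed
  qed
  from bij_betw_same_card[OF this] show ?thesis by simp
qed

section \<open>Upper bounds for ranked functions and their equality case\<close>

lemma sum_function_unit_mass: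
  "(\<Sum>v\<in>verts G. a (r v)) = (\<Sum>k<n. incr k * (real n - real k))"
  using sum_function_eq_layers[of "\<lambda>_. 1"] by (simp add: card_above_level of_nat_diff)

text \<open>Every set of vertices above a level avoids \<open>V0\<close>, so each layer has at most
  the full mass outside \<open>V0\<close>; the power mean inequality then treats the increments. The
  product form also makes sense when the energy is zero.\<close>

lemma mass_powr_le:
  assumes "1 \<le> p" and cut: "0 \<le> min_cut G" and m: "\<And>v. v \<in> verts G \<Longrightarrow> 0 \<le> m v"
  shows "(\<Sum>v\<in>verts G. a (r v) * m v) powr p * min_cut G
    \<le> real n powr (p - 1) * (\<Sum>v\<in>verts G - V0. m v) powr p * energy p G (\<lambda>v. a (r v))"
proof -
  let ?M = "\<Sum>v\<in>verts G - V0. m v"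
  have M: "0 \<le> ?M" using m by (auto intro: sum_nonneg)
  have "(\<Sum>v\<in>verts G. a (r v) * m v) \<le> (\<Sum>k<n. incr k * ?M)"
    unfolding sum_function_eq_layers using finite_verts m rank_V0
    by (intro sum_mono mult_left_mono sum_mono2 incr_nonneg) auto
  moreover have "0 \<le> (\<Sum>v\<in>verts G. a (r v) * m v)"
    using m a_nonneg rank_le by (auto intro!: sum_nonneg)
  ultimately have "(\<Sum>v\<in>verts G. a (r v) * m v) powr p \<le> ((\<Sum>k<n. incr k) * ?M) powr p"
    using assms(1) by (intro powr_mono2) (auto simp: sum_distrib_right)
  also have "\<dots> = (\<Sum>k<n. incr k) powr p * ?M powr p"
    by (rule powr_mult)
  also have "\<dots> \<le> real n powr (p - 1) * (\<Sum>k<n. incr k powr p) * ?M powr p"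
    using powr_sum_le_card_powr[of "{..<n}" p incr] assms(1) incr_nonneg
    by (intro mult_right_mono) auto
  finally have "(\<Sum>v\<in>verts G. a (r v) * m v) powr p * min_cut G
    \<le> real n powr (p - 1) * ?M powr p * (min_cut G * (\<Sum>k<n. incr k powr p))"
    by (drule_tac mult_right_mono[OF _ cut]) (simp add: mult_ac)
  also have "\<dots> \<le> real n powr (p - 1) * ?M powr p * energy p G (\<lambda>v. a (r v))"
    using layers_le_energy[OF assms(1)] by (intro mult_left_mono) auto
  finally show ?thesis .
qed

lemma mass_square_le:
  assumes "0 \<le> min_cut G"
  shows "(\<Sum>v\<in>verts G. a (r v))\<^sup>2 * min_cut G
    \<le> (\<Sum>k<n. (real n - real k)\<^sup>2) * energy 2 G (\<lambda>v. a (r v))"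
proof -
  let ?S = "\<Sum>k<n. (real n - real k)\<^sup>2"
  have "(\<Sum>v\<in>verts G. a (r v))\<^sup>2 \<le> (\<Sum>k<n. (incr k)\<^sup>2) * ?S"
    unfolding sum_function_unit_mass by (rule Cauchy_Schwarz_ineq_sum)
  then have "(\<Sum>v\<in>verts G. a (r v))\<^sup>2 * min_cut G \<le> ?S * (min_cut G * (\<Sum>k<n. (incr k)\<^sup>2))"
    by (drule_tac mult_right_mono[OF _ assms]) (simp add: mult_ac)
  also have "(\<Sum>k<n. (incr k)\<^sup>2) = (\<Sum>k<n. incr k powr 2)"
    using incr_nonneg by (intro sum.cong) auto
  also have "?S * (min_cut G * (\<Sum>k<n. incr k powr 2)) \<le> ?S * energy 2 G (\<lambda>v. a (r v))"
    by (intro mult_left_mono layers_le_energy) (auto intro!: sum_nonneg)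
  finally show ?thesis .
qed

text \<open>Every loss in the estimate must vanish: \<open>Z\<close> measures level cuts above the
  minimum, \<open>X\<close> edges that skip ranks, \<open>Y\<close> the potential, and
  \<open>Q * S - P\<^sup>2\<close> the Cauchy--Schwarz step. Positivity of the increments then
  transfers the vanishing to the graph data.\<close>

lemma extremal_structure:
  assumes cut: "0 < min_cut G" and pos: "0 < (\<Sum>v\<in>verts G. a (r v))"
    and extremal: "(\<Sum>k<n. (real n - real k)\<^sup>2) * energy 2 G (\<lambda>v. a (r v))
       \<le> (\<Sum>v\<in>verts G. a (r v))\<^sup>2 * min_cut G"
  shows "\<And>k. k < n \<Longrightarrow> level_cut k = min_cut G"
    and "\<And>v w. v \<in> verts G \<Longrightarrow> w \<in> verts G \<Longrightarrow> r v + 2 \<le> r w \<Longrightarrow> ewt G v w = 0"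
    and "\<And>v. v \<in> verts G - V0 \<Longrightarrow> pot G v = 0"
proof -
  define S where "S = (\<Sum>k<n. (real n - real k)\<^sup>2)"
  define P where "P = (\<Sum>k<n. incr k * (real n - real k))"
  define Q where "Q = (\<Sum>k<n. (incr k)\<^sup>2)"
  define E where "E = energy 2 G (\<lambda>v. a (r v))"
  define X where "X = (\<Sum>v\<in>verts G. \<Sum>w\<in>verts G. ewt G v w * excess 2 (r v) (r w))"
  define Y where "Y = (\<Sum>v\<in>verts G. pot G v * a (r v) powr 2)"
  define Z where "Z = (\<Sum>k<n. incr k powr 2 * (level_cut k - min_cut G))"
  have P: "P = (\<Sum>v\<in>verts G. a (r v))" by (simp add: P_def sum_function_unit_mass)
  have "0 < n"
    using pos unfolding sum_function_unit_mass by (cases n) auto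
  then have S: "0 < S" unfolding S_def by (intro sum_pos2[of _ 0]) auto
  have Q: "Q = (\<Sum>k<n. incr k powr 2)"
    unfolding Q_def using incr_nonneg by (intro sum.cong) auto
  have E: "E = min_cut G * Q + Z + (1 / 2 * X + Y)"
    unfolding E_def energy_eq_layers Q Z_def X_def Y_def
    by (simp add: algebra_simps sum_subtractf sum_distrib_left del: powr_numeral)
  have excess_term: "0 \<le> ewt G v w * excess 2 (r v) (r w)" if "v \<in> verts G" "w \<in> verts G" for v w
    using that by (intro mult_nonneg_nonneg ewt_nonneg excess_nonneg rank_le) auto
  have Z_term: "0 \<le> incr k powr 2 * (level_cut k - min_cut G)" if "k < n" for k
    using min_cut_le_level_cut[OF that] by simp
  have nonneg: "0 \<le> X" "0 \<le> Y" "0 \<le> Z"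
    unfolding X_def Y_def Z_def using pot_nonneg excess_term Z_term
    by (auto intro!: sum_nonneg simp del: powr_numeral)
  have SE: "S * E \<le> P\<^sup>2 * min_cut G" using extremal by (simp add: S_def E_def P)
  have PQ: "P\<^sup>2 \<le> Q * S" unfolding P_def Q_def S_def by (rule Cauchy_Schwarz_ineq_sum)
  \<comment> \<open>This is the total loss, split into the part from the energy and the part from
    Cauchy--Schwarz, both nonnegative.\<close>
  have "S * (Z + (1 / 2 * X + Y)) + min_cut G * (Q * S - P\<^sup>2) \<le> 0"
    using SE by (simp add: E algebra_simps)
  moreover have "0 \<le> S * (Z + (1 / 2 * X + Y))" "0 \<le> min_cut G * (Q * S - P\<^sup>2)"
    using S cut nonneg PQ by auto
  ultimately have "S * (Z + (1 / 2 * X + Y)) = 0" "min_cut G * (Q * S - P\<^sup>2) = 0" by linarith+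
  then have "Z + (1 / 2 * X + Y) = 0" and QSP: "Q * S = P\<^sup>2" using S cut by auto
  then have zero: "X = 0" "Y = 0" "Z = 0" using nonneg by linarith+
  \<comment> \<open>Since \<open>S\<close> and \<open>P\<close> are positive, the increments become
    a positive multiple of \<open>n - k\<close>.\<close>
  have "(\<Sum>k<n. (S * incr k - P * (real n - real k))\<^sup>2) = 0"
    using Cauchy_Schwarz_sum_defect[where A = "{..<n}" and d = incr and M = "\<lambda>k. real n - real k"] QSP
    by (simp add: S_def[symmetric] P_def[symmetric] Q_def[symmetric] mult.commute)
  then have proportional: "S * incr k = P * (real n - real k)" if "k < n" for k
    using that by (subst (asm) sum_nonneg_eq_0_iff) auto
  have incr_pos: "0 < incr k" if "k < n" for k
  proof -
    have "0 < S * incr k" using proportional[OF that] pos that by (simp add: P)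
    then show ?thesis using S by (simp add: zero_less_mult_iff)
  qed
  show "level_cut k = min_cut G" if "k < n" for k
  proof -
    have "incr k powr 2 * (level_cut k - min_cut G) = 0"
      using zero(3) Z_term that unfolding Z_def by (subst (asm) sum_nonneg_eq_0_iff) auto
    then show ?thesis using incr_pos[OF that] by simp
  qed
  show "ewt G v w = 0" if "v \<in> verts G" "w \<in> verts G" "r v + 2 \<le> r w" for v w
  proof -
    have "(\<Sum>w\<in>verts G. ewt G v w * excess 2 (r v) (r w)) = 0"
      using zero(1) that finite_verts excess_term unfolding X_def
      by (subst (asm) sum_nonneg_eq_0_iff) (auto intro!: sum_nonneg)
    then have "ewt G v w * excess 2 (r v) (r w) = 0"
      using that finite_verts excess_term by (subst (asm) sum_nonneg_eq_0_iff) auto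
    moreover have "0 < excess 2 (r v) (r w)"
      using that rank_le incr_pos by (intro excess_pos) auto
    ultimately show ?thesis by simp
  qed
  show "pot G v = 0" if v: "v \<in> verts G - V0" for v
  proof -
    have "pot G v * a (r v) powr 2 = 0"
      using zero(2) v finite_verts pot_nonneg unfolding Y_def
      by (subst (asm) sum_nonneg_eq_0_iff) auto
    moreover have "0 < a (r v)"
      unfolding a_eq_sum_incr[of "r v"]
    proof (rule sum_pos)
      show "0 < incr k" if "k \<in> {..<r v}" for k
        using incr_pos[of k] rank_le[of v] that v by simp
    qed (use rank_in[OF v] in \<open>auto simp: lessThan_empty_iff\<close>)
    ultimately show ?thesis by simp
  qed
qed

text \<open>Counterpart of \<open>extremal_structure\<close>: under the three conditions found
  there, the remainder in the layer identity disappears.\<close>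

lemma energy_eq_layers_consecutive:
  assumes no_skip: "\<And>v w. v \<in> verts G \<Longrightarrow> w \<in> verts G \<Longrightarrow> r v + 2 \<le> r w \<Longrightarrow> ewt G v w = 0"
    and cut: "\<And>k. k < n \<Longrightarrow> level_cut k = c"
    and pot: "\<And>v. v \<in> verts G - V0 \<Longrightarrow> pot G v = 0"
  shows "energy p G (\<lambda>v. a (r v)) = c * (\<Sum>k<n. incr k powr p)"
proof -
  have X: "ewt G v w * excess p (r v) (r w) = 0" if "v \<in> verts G" "w \<in> verts G" for v w
  proof -
    consider "r v + 2 \<le> r w" | "r w + 2 \<le> r v" | "r v \<le> Suc (r w)" "r w \<le> Suc (r v)" by linarith
    then show ?thesis
    proof cases
      case 2
      then show ?thesis using no_skip[of w v] ewt_sym that by simp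
    qed (use that no_skip rank_le in \<open>auto simp: excess_eq_0\<close>)
  qed
  \<comment> \<open>On \<open>V0\<close> the potential may be positive, but \<open>a 0 = 0\<close>
    and \<open>0 powr p\<close> is \<open>0\<close>.\<close>
  have Y: "pot G v * a (r v) powr p = 0" if "v \<in> verts G" for v
    using that pot[of v] rank_V0[of v] a_0 by (cases "v \<in> V0") auto
  show ?thesis
    unfolding energy_eq_layers by (simp add: X Y cut sum_distrib_left mult.commute)
qed

end

text \<open>Sort the vertices outside \<open>V0\<close> by their values under \<open>f\<close>; ties
  are broken by the position in the list.\<close>

lemma exists_ranked_function:
  assumes G: "finite_graph G" and V0: "V0 \<noteq> {}" "V0 \<subset> verts G"
    and n: "n = card (verts G - V0)"
    and f0: "\<And>v. v \<in> V0 \<Longrightarrow> f v = 0" and f_nonneg: "\<And>v. v \<in> verts G \<Longrightarrow> 0 \<le> f v"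
  obtains r a where "ranked_function G V0 n r a" "\<And>v. v \<in> verts G \<Longrightarrow> f v = a (r v)"
proof -
  let ?W = "verts G - V0"
  have "finite ?W" using G by (simp add: finite_graph_def)
  then obtain xs where xs: "set xs = ?W" "distinct xs" using finite_distinct_list by blast
  define ys where "ys = sort_key f xs"
  have ys: "set ys = ?W" "distinct ys" "sorted (map f ys)" using xs by (auto simp: ys_def)
  then have len: "length ys = n" using n distinct_card by fastforce
  have nth: "bij_betw ((!) ys) {..<n} ?W"
    using bij_betw_nth[OF ys(2)] len ys(1) by simp
  \<comment> \<open>List positions start at 0, so they are shifted by one to reserve rank 0 for
    \<open>V0\<close>; accordingly \<open>a (Suc k)\<close> is the value at position
    \<open>k\<close>.\<close>
  define r where "r v = (if v \<in> V0 then 0 else Suc (inv_into {..<n} ((!) ys) v))" for v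
  define a where "a i = (case i of 0 \<Rightarrow> 0 | Suc k \<Rightarrow> f (ys ! k))" for i
  have "bij_betw Suc {..<n} {1..n}"
    by (simp add: bij_betw_def image_Suc_lessThan)
  then have "bij_betw (Suc \<circ> inv_into {..<n} ((!) ys)) ?W {1..n}"
    by (rule bij_betw_trans[OF bij_betw_inv_into[OF nth]])
  then have r: "bij_betw r ?W {1..n}"
    by (rule bij_betw_cong[THEN iffD1, rotated]) (simp add: r_def)
  have "ranked_function G V0 n r a"
  proof
    show "a k \<le> a (Suc k)" if "k < n" for k
    proof (cases k)
      case 0
      then have "ys ! k \<in> ?W" using ys(1) len that nth_mem by blast
      then show ?thesis using 0 f_nonneg by (simp add: a_def)
    next
      case (Suc j)
      then show ?thesis
        using sorted_nth_mono[OF ys(3), of j k] that len by (simp add: a_def)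
    qed
  qed (use G V0 r in \<open>auto simp: r_def a_def\<close>)
  moreover have "f v = a (r v)" if "v \<in> verts G" for v
  proof (cases "v \<in> V0")
    case False
    then have "ys ! inv_into {..<n} ((!) ys) v = v"
      using nth that by (simp add: bij_betw_inv_into_right)
    then show ?thesis using False by (simp add: r_def a_def)
  qed (simp add: f0 r_def a_def)
  ultimately show ?thesis using that by blast
qed

section \<open>Energies and torsional rigidity\<close>

lemma energy_cong:
  assumes "\<And>v. v \<in> verts G \<Longrightarrow> u v = w v"
  shows "energy p G u = energy p G w"
  using assms by (simp add: energy_def cong: sum.cong)

lemma energy_nonneg: "finite_graph G \<Longrightarrow> 0 \<le> energy p G u"
  unfolding energy_def finite_graph_def by (auto intro!: add_nonneg_nonneg sum_nonneg)

lemma energy_abs_le: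
  assumes "finite_graph G" "0 \<le> p"
  shows "energy p G (\<lambda>v. \<bar>u v\<bar>) \<le> energy p G u"
proof -
  have "\<bar>\<bar>x\<bar> - \<bar>y\<bar>\<bar> powr p \<le> \<bar>x - y\<bar> powr p" for x y :: real
    using assms(2) by (intro powr_mono2) auto
  then show ?thesis
    using assms(1) unfolding energy_def finite_graph_def
    by (auto intro!: sum_mono mult_left_mono divide_right_mono)
qed

lemma energy_scale:
  assumes "0 \<le> c"
  shows "energy p G (\<lambda>v. c * u v) = c powr p * energy p G u"
proof -
  have diff: "\<bar>c * x - c * y\<bar> powr p = c powr p * \<bar>x - y\<bar> powr p" for x y
    using assms by (simp add: right_diff_distrib[symmetric] abs_mult powr_mult)
  have abs: "\<bar>c * x\<bar> powr p = c powr p * \<bar>x\<bar> powr p" for x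
    using assms by (simp add: abs_mult powr_mult)
  show ?thesis
    unfolding energy_def diff abs by (simp add: distrib_left sum_distrib_left mult_ac)
qed

text \<open>Passing to the absolute value keeps the numerator and does not increase the energy, so
  nonnegative functions suffice.\<close>

lemma torsional_rigidity_le:
  assumes G: "finite_graph G" and "0 \<le> p" "0 < \<eta>" "0 \<le> C"
    and le: "\<And>f. (\<And>v. v \<in> V0 \<Longrightarrow> f v = 0) \<Longrightarrow> (\<And>v. v \<in> verts G \<Longrightarrow> 0 \<le> f v) \<Longrightarrow>
      (\<Sum>v\<in>verts G. f v * vmass G v) powr p * \<eta> \<le> C * energy p G f"
  shows "torsional_rigidity p G V0 \<le> ereal (C / \<eta>)"
  unfolding torsional_rigidity_def
proof (rule SUP_least)
  fix u :: "'a \<Rightarrow> real"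
  assume "u \<in> {u. (\<forall>v\<in>V0. u v = 0) \<and> (\<exists>v\<in>verts G. u v \<noteq> 0)}"
  then obtain w where u: "\<forall>v\<in>V0. u v = 0" and w: "w \<in> verts G" "u w \<noteq> 0" by blast
  let ?P = "\<Sum>v\<in>verts G. \<bar>u v\<bar> * vmass G v"
  have "0 < ?P"
    using G w by (intro sum_pos2[of _ w]) (auto simp: finite_graph_def less_imp_le)
  have "?P powr p * \<eta> \<le> C * energy p G (\<lambda>v. \<bar>u v\<bar>)"
    using u by (intro le) auto
  also have "\<dots> \<le> C * energy p G u"
    using assms by (intro mult_left_mono energy_abs_le) auto
  finally have *: "?P powr p * \<eta> \<le> C * energy p G u" .
  moreover have "0 < ?P powr p * \<eta>" using \<open>0 < ?P\<close> \<open>0 < \<eta>\<close> by simp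
  \<comment> \<open>Zero energy would make the right-hand side of the estimate zero although the
    left-hand side is positive; hence the quotient is a genuine one.\<close>
  ultimately have "0 < energy p G u"
    using energy_nonneg[OF G, of p u] by (cases "energy p G u = 0") auto
  then show "ereal (?P powr p) / ereal (energy p G u) \<le> ereal (C / \<eta>)"
    using * \<open>0 < \<eta>\<close> by (simp add: field_simps)
qed

section \<open>Existence of an energy minimizer\<close>

lemma continuous_on_energy:
  assumes "0 < p"
  shows "continuous_on A (energy p G)"
proof -
  have coord: "continuous_on A (\<lambda>u. u v)" for v :: 'a and A :: "('a \<Rightarrow> real) set"
    by (rule continuous_on_subset[OF continuous_on_product_coordinates]) auto
  show ?thesis
    unfolding energy_def[abs_def]
    \<comment> \<open>The positive exponent gives continuity of the power also where its base is
      zero.\<close>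
    by (intro continuous_intros continuous_on_powr' coord ballI impI conjI) (use assms in auto)
qed

text \<open>Minimize over the compact set of nonnegative functions with total 1. Homogeneity of
  degree \<open>p\<close> extends minimality to all admissible \<open>f\<close>.\<close>

lemma exists_energy_minimizer:
  assumes G: "finite_graph G" and V0: "V0 \<subset> verts G" and p: "0 < p"
  obtains u where "\<And>v. v \<in> V0 \<Longrightarrow> u v = 0" "\<And>v. v \<in> verts G \<Longrightarrow> 0 \<le> u v"
    "(\<Sum>v\<in>verts G. u v) = 1"
    "\<And>f. (\<And>v. v \<in> V0 \<Longrightarrow> f v = 0) \<Longrightarrow> (\<And>v. v \<in> verts G \<Longrightarrow> 0 \<le> f v) \<Longrightarrow>
      (\<Sum>v\<in>verts G. f v) powr p * energy p G u \<le> energy p G f"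
proof -
  let ?W = "verts G - V0"
  have fin: "finite (verts G)" using G by (simp add: finite_graph_def)
  \<comment> \<open>Functions are defined on the whole type. Pinning them to 0 outside
    \<open>?W\<close> makes every factor compact, so Tychonoff's theorem applies.\<close>
  define B where "B v = (if v \<in> ?W then {0..1} else {0::real})" for v
  define K where "K = PiE UNIV B \<inter> {u. (\<Sum>v\<in>verts G. u v) = 1}"
  have "compactin (product_topology (\<lambda>_. euclidean) UNIV) (PiE UNIV B)"
    by (simp add: compactin_PiE B_def)
  then have "compact (PiE UNIV B)"
    by (simp add: euclidean_product_topology)
  moreover have "closed {u. (\<Sum>v\<in>verts G. u v) = (1::real)}"
    by (intro closed_Collect_eq continuous_on_sum continuous_on_product_coordinates continuous_on_const)
  ultimately have "compact K" unfolding K_def by (rule compact_Int_closed)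
  have normalized: "(\<lambda>v. if v \<in> ?W then f v / (\<Sum>v\<in>verts G. f v) else 0) \<in> K"
    if f: "\<And>v. v \<in> V0 \<Longrightarrow> f v = 0" "\<And>v. v \<in> verts G \<Longrightarrow> 0 \<le> f v"
      and s: "0 < (\<Sum>v\<in>verts G. f v)" for f
  proof -
    let ?s = "\<Sum>v\<in>verts G. f v"
    have "f v / ?s \<in> {0..1}" if "v \<in> ?W" for v
      using member_le_sum[of v "verts G" f] that f s fin by (simp add: field_simps)
    moreover have "(\<Sum>v\<in>verts G. if v \<in> ?W then f v / ?s else 0) = 1"
    proof -
      have "(\<Sum>v\<in>verts G. if v \<in> ?W then f v / ?s else 0) = (\<Sum>v\<in>verts G. f v / ?s)"
        using f by (intro sum.cong) auto
      then show ?thesis using s by (simp add: sum_divide_distrib[symmetric])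
    qed
    ultimately show ?thesis by (auto simp: K_def B_def)
  qed
  have "K \<noteq> {}"
  proof -
    obtain w where w: "w \<in> ?W" using V0 by auto
    have "0 < (\<Sum>v\<in>verts G. of_bool (v = w) :: real)"
      using w fin by (intro sum_pos2[of _ w]) auto
    from normalized[of "\<lambda>v. of_bool (v = w)", OF _ _ this] w show ?thesis by auto
  qed
  then obtain u where u: "u \<in> K" "\<And>w. w \<in> K \<Longrightarrow> energy p G u \<le> energy p G w"
    using continuous_attains_inf[OF \<open>compact K\<close> _ continuous_on_energy[OF p]] by blast
  have uB: "u v \<in> B v" for v using u(1) by (auto simp: K_def)
  show ?thesis
  proof (rule that)
    show "u v = 0" if "v \<in> V0" for v using uB[of v] that by (simp add: B_def)
    show "0 \<le> u v" for v using uB[of v] by (simp add: B_def split: if_splits)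
    show "(\<Sum>v\<in>verts G. u v) = 1" using u(1) by (simp add: K_def)
    fix f :: "'a \<Rightarrow> real"
    assume f: "\<And>v. v \<in> V0 \<Longrightarrow> f v = 0" "\<And>v. v \<in> verts G \<Longrightarrow> 0 \<le> f v"
    let ?s = "\<Sum>v\<in>verts G. f v"
    have s: "0 \<le> ?s" using f by (intro sum_nonneg) auto
    show "?s powr p * energy p G u \<le> energy p G f"
    proof (cases "?s = 0")
      case True
      then show ?thesis using energy_nonneg[OF G] by simp
    next
      case False
      then have "0 < ?s" using s by simp
      have "energy p G u \<le> energy p G (\<lambda>v. if v \<in> ?W then f v / ?s else 0)"
        by (intro u(2) normalized f \<open>0 < ?s\<close>)
      also have "\<dots> = energy p G (\<lambda>v. inverse ?s * f v)"
        using f by (intro energy_cong) (auto simp: field_simps)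
      also have "\<dots> = inverse ?s powr p * energy p G f"
        using s by (intro energy_scale) simp
      finally have "?s powr p * energy p G u \<le> ?s powr p * (inverse ?s powr p * energy p G f)"
        by (intro mult_left_mono) auto
      also have "\<dots> = (?s * inverse ?s) powr p * energy p G f"
        by (simp only: powr_mult mult.assoc)
      also have "\<dots> = energy p G f" using \<open>0 < ?s\<close> by simp
      finally show ?thesis .
    qed
  qed
qed

section \<open>The identified graph\<close>

lemma verts_identify:
  assumes "V0 \<noteq> {}" "V0 \<subseteq> verts G"
  shows "verts (identify G V0) = (\<lambda>v. if v \<in> V0 then None else Some v) ` verts G"
  using assms by (auto simp: identify_def)

lemma card_verts_identify:
  assumes "finite_graph G"
  shows "card (verts (identify G V0)) = Suc (card (verts G - V0))"
  using assms by (simp add: identify_def finite_graph_def card_image)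

lemma ewt_identify_self:
  assumes "finite_graph G" "x \<in> verts (identify G V0)"
  shows "ewt (identify G V0) x x = 0"
  using assms by (auto simp: identify_def finite_graph_def split: option.splits)

context vertex_ranking
begin

lemma card_non_Dirichlet: "card (verts G - V0) = n"
  using bij_betw_same_card[OF bij_rank] by simp

text \<open>The fibre of the rank over 0 is \<open>V0\<close> and every other fibre is a single
  vertex, so the double sum adds exactly the parallel edges. The case \<open>i = j = 0\<close> is
  excluded because identification deletes the edges inside \<open>V0\<close>.\<close>

lemma ewt_identify_eq_level_sum:
  assumes e: "\<And>v. v \<in> verts G \<Longrightarrow> e (r v) = (if v \<in> V0 then None else Some v)"
    and ij: "i \<le> n" "j \<le> n" "i \<noteq> j"
  shows "ewt (identify G V0) (e i) (e j)
    = (\<Sum>v\<in>{v \<in> verts G. r v = i}. \<Sum>w\<in>{w \<in> verts G. r w = j}. ewt G v w)"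
proof -
  have zero: "{v \<in> verts G. r v = 0} = V0" "e 0 = None"
  proof -
    show "{v \<in> verts G. r v = 0} = V0" using rank_eq_0_iff V0 by auto
    obtain z where "z \<in> V0" using V0 by auto
    then show "e 0 = None" using e[of z] rank_V0 V0 by auto
  qed
  have pos: "\<exists>v. {v \<in> verts G. r v = k} = {v} \<and> e k = Some v" if k: "k \<le> n" "k \<noteq> 0" for k
  proof -
    obtain v where v: "v \<in> verts G" "r v = k" using rank_surj k by blast
    then have "v \<notin> V0" using k rank_V0 by auto
    have "w = v" if "w \<in> verts G" "r w = k" for w
    proof -
      have "w \<notin> V0" using that k rank_V0 by auto
      then show ?thesis
        using that v \<open>v \<notin> V0\<close> bij_rank by (auto simp: bij_betw_def dest!: inj_onD)
    qed
    then have "{v \<in> verts G. r v = k} = {v}" using v by blast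
    then show ?thesis using v e[of v] \<open>v \<notin> V0\<close> by auto
  qed
  show ?thesis
  proof (cases "i = 0")
    case True
    then show ?thesis using pos[of j] ij zero by (auto simp: identify_def)
  next
    case False
    then show ?thesis
      using pos[of i] pos[of j] ij zero by (cases "j = 0") (auto simp: identify_def)
  qed
qed

lemma level_sum_commute:
  "(\<Sum>v\<in>{v \<in> verts G. r v = i}. \<Sum>w\<in>{w \<in> verts G. r w = j}. ewt G v w)
   = (\<Sum>v\<in>{v \<in> verts G. r v = j}. \<Sum>w\<in>{w \<in> verts G. r w = i}. ewt G v w)"
  by (subst sum.swap) (auto intro!: sum.cong ewt_sym)

text \<open>The edge between the ranks \<open>k\<close> and \<open>Suc k\<close> of the identified
  graph carries the whole level cut \<open>c\<close>, and all other weights vanish. Enumerating by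
  rank therefore exhibits a path starting at \<open>None\<close>.\<close>

lemma dirichlet_path_if_consecutive:
  assumes c: "0 < c"
    and no_skip: "\<And>v w. v \<in> verts G \<Longrightarrow> w \<in> verts G \<Longrightarrow> r v + 2 \<le> r w \<Longrightarrow> ewt G v w = 0"
    and cut: "\<And>k. k < n \<Longrightarrow> level_cut k = c"
  shows "dirichlet_path G V0"
    and "\<And>x y. x \<in> verts (identify G V0) \<Longrightarrow> y \<in> verts (identify G V0) \<Longrightarrow>
      ewt (identify G V0) x y > 0 \<Longrightarrow> ewt (identify G V0) x y = c"
proof -
  let ?H = "identify G V0"
  define e where "e i = (if i = 0 then None else Some (inv_into (verts G - V0) r i))" for i
  have e: "e (r v) = (if v \<in> V0 then None else Some v)" if "v \<in> verts G" for v
    using that rank_eq_0_iff[of v] bij_rank by (auto simp: e_def bij_betw_def)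
  have ranks: "{..n} = r ` verts G" using rank_le rank_surj by (force simp: image_iff)
  have image: "e ` {..n} = verts ?H"
    unfolding ranks verts_identify[OF V0] image_image using e by (intro image_cong) auto
  have inj: "inj_on e {..n}"
  proof (rule inj_onI)
    fix i j assume ij: "i \<in> {..n}" "j \<in> {..n}" "e i = e j"
    then obtain v w where vw: "v \<in> verts G" "w \<in> verts G" "i = r v" "j = r w"
      unfolding ranks by blast
    then show "i = j" using ij(3) e rank_V0 by (auto split: if_splits)
  qed
  have range: "{..<card (verts ?H)} = {..n}"
    by (simp add: card_verts_identify[OF graph] card_non_Dirichlet lessThan_Suc_atMost)
  have consecutive: "ewt ?H (e k) (e (Suc k)) = c" "ewt ?H (e (Suc k)) (e k) = c" if "k < n" for k
    using that level_cut_eq_consecutive[OF no_skip, of k] cut[OF that] level_sum_commute[of k "Suc k"]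
    by (simp_all add: ewt_identify_eq_level_sum[OF e])
  have skip: "ewt ?H (e i) (e j) = 0" "ewt ?H (e j) (e i) = 0" if "i + 2 \<le> j" "j \<le> n" for i j
    using that level_sum_commute[of i j] by (simp_all add: ewt_identify_eq_level_sum[OF e] no_skip)
  have weight: "ewt ?H (e i) (e j) = (if \<bar>int i - int j\<bar> = 1 then c else 0)"
    if "i \<le> n" "j \<le> n" for i j
  proof -
    consider "i = j" | "j = Suc i" | "i = Suc j" | "i + 2 \<le> j" | "j + 2 \<le> i" by linarith
    then show ?thesis
    proof cases
      case 1
      then show ?thesis using ewt_identify_self[OF graph, of "e i"] image that by auto
    qed (use that consecutive skip in auto)
  qed
  have "path_enumeration ?H e"
    unfolding path_enumeration_def range
    using image inj weight c by (auto simp: bij_betw_def range card_verts_identify[OF graph] card_non_Dirichlet)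
  then show "dirichlet_path G V0" by (auto simp: dirichlet_path_def e_def)
  show "ewt ?H x y = c" if "x \<in> verts ?H" "y \<in> verts ?H" "ewt ?H x y > 0" for x y
    using that weight unfolding image[symmetric] by (auto split: if_splits)
qed

end

text \<open>Positions along the identified path, counted from the Dirichlet end, serve as ranks of
  the vertices of \<open>G\<close>.\<close>

lemma dirichlet_path_ranking:
  assumes G: "finite_graph G" and V0: "V0 \<noteq> {}" "V0 \<subset> verts G" and n: "n = card (verts G - V0)"
    and path: "dirichlet_path G V0"
    and weights: "\<And>x y. x \<in> verts (identify G V0) \<Longrightarrow> y \<in> verts (identify G V0) \<Longrightarrow>
      ewt (identify G V0) x y > 0 \<Longrightarrow> ewt (identify G V0) x y = c"
  obtains r where "vertex_ranking G V0 n r"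
    "\<And>v w. v \<in> verts G \<Longrightarrow> w \<in> verts G \<Longrightarrow> r v + 2 \<le> r w \<Longrightarrow> ewt G v w = 0"
    "\<And>k. k < n \<Longrightarrow> vertex_ranking.level_cut G r k = c"
proof -
  let ?H = "identify G V0"
  obtain e where e: "path_enumeration ?H e" "e 0 = None" using path by (auto simp: dirichlet_path_def)
  have range: "{..<card (verts ?H)} = {..n}"
    by (simp add: card_verts_identify[OF G] n lessThan_Suc_atMost)
  have bij: "bij_betw e {..n} (verts ?H)" using e range by (simp add: path_enumeration_def)
  have edge: "ewt ?H (e i) (e j) > 0 \<longleftrightarrow> \<bar>int i - int j\<bar> = 1" if "i \<le> n" "j \<le> n" for i j
    using e(1) that by (simp add: path_enumeration_def card_verts_identify[OF G] n)
  define q where "q v = (if v \<in> V0 then None else Some v)" for v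
  define r where "r v = inv_into {..n} e (q v)" for v
  have q: "q v \<in> verts ?H" if "v \<in> verts G" for v using that by (auto simp: q_def identify_def)
  have er: "e (r v) = q v" if "v \<in> verts G" for v
    using bij_betw_inv_into_right[OF bij q[OF that]] by (simp add: r_def)
  have r0: "r v = 0" if "v \<in> V0" for v
    using bij_betw_inv_into_left[OF bij, of 0] that e(2) by (simp add: r_def q_def)
  have inv: "bij_betw (inv_into {..n} e) (verts ?H) {..n}" by (rule bij_betw_inv_into[OF bij])
  have "bij_betw (inv_into {..n} e) (Some ` (verts G - V0)) {1..n}"
  proof -
    have "inv_into {..n} e None = 0" using bij_betw_inv_into_left[OF bij, of 0] e(2) by simp
    then have "bij_betw (inv_into {..n} e) (verts ?H - {None}) ({..n} - {0})"
      using inv by (intro bij_betw_DiffI) (auto simp: identify_def bij_betw_def)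
    moreover have "verts ?H - {None} = Some ` (verts G - V0)" by (auto simp: identify_def)
    moreover have "{..n} - {0} = {1..n}" by auto
    ultimately show ?thesis by simp
  qed
  moreover have "bij_betw Some (verts G - V0) (Some ` (verts G - V0))" by (simp add: bij_betw_def)
  ultimately have "bij_betw (inv_into {..n} e \<circ> Some) (verts G - V0) {1..n}"
    using bij_betw_trans by blast
  then have "bij_betw r (verts G - V0) {1..n}"
    by (rule bij_betw_cong[THEN iffD1, rotated]) (simp add: r_def q_def)
  then interpret vertex_ranking G V0 n r
    using G V0 r0 by unfold_locales auto
  have sum_eq: "ewt ?H (e i) (e j)
      = (\<Sum>v\<in>{v \<in> verts G. r v = i}. \<Sum>w\<in>{w \<in> verts G. r w = j}. ewt G v w)"
    if "i \<le> n" "j \<le> n" "i \<noteq> j" for i j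
    using that by (intro ewt_identify_eq_level_sum) (auto simp: er q_def)
  have no_skip: "ewt G v w = 0" if vw: "v \<in> verts G" "w \<in> verts G" "r v + 2 \<le> r w" for v w
  proof -
    \<comment> \<open>Nonadjacent positions carry no positive total weight; the individual weights
      are nonnegative, so each of them is zero.\<close>
    have "\<not> ewt ?H (e (r v)) (e (r w)) > 0" using edge[of "r v" "r w"] vw rank_le by auto
    then have "(\<Sum>x\<in>{x \<in> verts G. r x = r v}. \<Sum>y\<in>{y \<in> verts G. r y = r w}. ewt G x y) \<le> 0"
      using sum_eq[of "r v" "r w"] vw rank_le by auto
    moreover have "ewt G v w \<le> (\<Sum>y\<in>{y \<in> verts G. r y = r w}. ewt G v y)"
      using vw finite_verts ewt_nonneg by (intro member_le_sum) auto
    moreover have "(\<Sum>y\<in>{y \<in> verts G. r y = r w}. ewt G v y)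
        \<le> (\<Sum>x\<in>{x \<in> verts G. r x = r v}. \<Sum>y\<in>{y \<in> verts G. r y = r w}. ewt G x y)"
      using vw finite_verts ewt_nonneg
      by (intro member_le_sum[of v _ "\<lambda>x. \<Sum>y\<in>{y \<in> verts G. r y = r w}. ewt G x y"]) (auto intro!: sum_nonneg)
    ultimately show ?thesis using ewt_nonneg[OF vw(1,2)] by linarith
  qed
  have "level_cut k = c" if "k < n" for k
  proof -
    have "ewt ?H (e k) (e (Suc k)) = level_cut k"
      using sum_eq[of k "Suc k"] that level_cut_eq_consecutive[OF no_skip, of k] by simp
    moreover have "ewt ?H (e k) (e (Suc k)) > 0" using edge[of k "Suc k"] that by simp
    moreover have "e k \<in> verts ?H" "e (Suc k) \<in> verts ?H"
      using bij that by (auto simp: bij_betw_def)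
    ultimately show ?thesis using weights by simp
  qed
  then show ?thesis using that vertex_ranking_axioms no_skip by blast
qed

section \<open>The extremal case\<close>

text \<open>The test function with increments \<open>n - k\<close> has total \<open>S\<close> and
  energy \<open>c * S\<close>, where \<open>S\<close> is the sum of the squares of the increments;
  its quotient is \<open>S / c\<close>.\<close>

lemma torsional_rigidity_path_ge:
  assumes G: "finite_graph G" and V0: "V0 \<noteq> {}" "V0 \<subset> verts G" and n: "n = card (verts G - V0)"
    and mass: "\<And>v. v \<in> verts G \<Longrightarrow> vmass G v = 1"
    and c: "0 < c"
    and path: "dirichlet_path G V0"
    and weights: "\<And>x y. x \<in> verts (identify G V0) \<Longrightarrow> y \<in> verts (identify G V0) \<Longrightarrow>
      ewt (identify G V0) x y > 0 \<Longrightarrow> ewt (identify G V0) x y = c"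
    and pot: "\<And>v. v \<in> verts G - V0 \<Longrightarrow> pot G v = 0"
  shows "ereal ((\<Sum>k<n. (real n - real k)\<^sup>2) / c) \<le> torsional_rigidity 2 G V0"
proof -
  obtain r where r: "vertex_ranking G V0 n r"
    "\<And>v w. v \<in> verts G \<Longrightarrow> w \<in> verts G \<Longrightarrow> r v + 2 \<le> r w \<Longrightarrow> ewt G v w = 0"
    "\<And>k. k < n \<Longrightarrow> vertex_ranking.level_cut G r k = c"
    using dirichlet_path_ranking[OF G V0 n path weights] by blast
  \<comment> \<open>Equality in the Cauchy--Schwarz step requires increments proportional to the number of
    vertices above each level.\<close>
  define a where "a i = (\<Sum>k<i. real n - real k)" for i
  interpret ranked_function G V0 n r a
    using r(1) by (auto simp: ranked_function_def ranked_function_axioms_def a_def)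
  let ?S = "\<Sum>k<n. (real n - real k)\<^sup>2"
  let ?u = "\<lambda>v. a (r v)"
  have incr: "incr k = real n - real k" for k by (simp add: incr_def a_def)
  have "energy 2 G ?u = c * (\<Sum>k<n. incr k powr 2)"
    using r(2,3) pot by (rule energy_eq_layers_consecutive)
  also have "(\<Sum>k<n. incr k powr 2) = ?S"
    by (intro sum.cong) (auto simp: incr)
  finally have E: "energy 2 G ?u = c * ?S" .
  have mass_eq: "(\<Sum>v\<in>verts G. \<bar>?u v\<bar> * vmass G v) = (\<Sum>v\<in>verts G. ?u v)"
    using a_nonneg rank_le mass by (intro sum.cong) auto
  also have "\<dots> = ?S"
    by (simp add: sum_function_unit_mass incr power2_eq_square)
  finally have P: "(\<Sum>v\<in>verts G. \<bar>?u v\<bar> * vmass G v) = ?S" .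
  have "0 < n" using assms(3) n finite_verts by (auto simp: card_gt_0_iff)
  then have S: "0 < ?S" by (intro sum_pos2[of _ 0]) auto
  have "\<exists>v\<in>verts G. ?u v \<noteq> 0"
    using S P by (metis (no_types, lifting) abs_zero less_irrefl mult_zero_left sum.neutral)
  then have "ereal ((\<Sum>v\<in>verts G. \<bar>?u v\<bar> * vmass G v) powr 2) / ereal (energy 2 G ?u)
      \<le> torsional_rigidity 2 G V0"
    unfolding torsional_rigidity_def using rank_V0 a_0 by (intro SUP_upper) auto
  moreover have "ereal (?S powr 2) / ereal (c * ?S) = ereal (?S / c)"
    using S c by (simp add: power2_eq_square)
  ultimately show ?thesis by (simp only: P E)
qed

text \<open>The energy minimizer \<open>u\<close> of total 1 realizes the supremum, so the assumed
  lower bound makes \<open>u\<close> extremal in \<open>mass_square_le\<close>, and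
  \<open>extremal_structure\<close> yields the path.\<close>

lemma path_if_torsional_rigidity_ge:
  assumes G: "finite_graph G" and V0: "V0 \<noteq> {}" "V0 \<subset> verts G" and n: "n = card (verts G - V0)"
    and mass: "\<And>v. v \<in> verts G \<Longrightarrow> vmass G v = 1"
    and cut: "0 < min_cut G"
    and ge: "ereal ((\<Sum>k<n. (real n - real k)\<^sup>2) / min_cut G) \<le> torsional_rigidity 2 G V0"
  shows "dirichlet_path G V0"
    and "\<And>x y. x \<in> verts (identify G V0) \<Longrightarrow> y \<in> verts (identify G V0) \<Longrightarrow>
      ewt (identify G V0) x y > 0 \<Longrightarrow> ewt (identify G V0) x y = min_cut G"
    and "\<And>v. v \<in> verts G - V0 \<Longrightarrow> pot G v = 0"
proof -
  let ?S = "\<Sum>k<n. (real n - real k)\<^sup>2"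
  obtain u where u: "\<And>v. v \<in> V0 \<Longrightarrow> u v = 0" "\<And>v. v \<in> verts G \<Longrightarrow> 0 \<le> u v"
    "(\<Sum>v\<in>verts G. u v) = 1"
    and min: "\<And>f. (\<And>v. v \<in> V0 \<Longrightarrow> f v = 0) \<Longrightarrow> (\<And>v. v \<in> verts G \<Longrightarrow> 0 \<le> f v) \<Longrightarrow>
      (\<Sum>v\<in>verts G. f v) powr 2 * energy 2 G u \<le> energy 2 G f"
    using exists_energy_minimizer[OF G V0(2), of 2] by (metis zero_less_numeral)
  obtain r a where "ranked_function G V0 n r a" and ua: "\<And>v. v \<in> verts G \<Longrightarrow> u v = a (r v)"
    using exists_ranked_function[where f = u, OF G V0 n] u by metis
  then interpret ranked_function G V0 n r a by simp
  have E: "energy 2 G u = energy 2 G (\<lambda>v. a (r v))" using ua by (rule energy_cong)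
  have P: "(\<Sum>v\<in>verts G. a (r v)) = 1" using u(3) ua by simp
  \<comment> \<open>Positivity of the minimal cut weight thus excludes zero energy.\<close>
  have "min_cut G \<le> ?S * energy 2 G u" using mass_square_le cut P E by simp
  then have "energy 2 G u \<noteq> 0" using cut by auto
  then have Epos: "0 < energy 2 G u" using energy_nonneg[OF G, of 2 u] by simp
  \<comment> \<open>Minimality of \<open>u\<close> is the premise of
    \<open>torsional_rigidity_le\<close> with constant 1 and \<open>energy 2 G u\<close> in place of
    the cut weight.\<close>
  have "torsional_rigidity 2 G V0 \<le> ereal (1 / energy 2 G u)"
    using min mass by (intro torsional_rigidity_le[OF G _ Epos]) (auto cong: sum.cong)
  then have "?S / min_cut G \<le> 1 / energy 2 G u" using ge order_trans by fastforce
  then have ext: "?S * energy 2 G (\<lambda>v. a (r v)) \<le> (\<Sum>v\<in>verts G. a (r v))\<^sup>2 * min_cut G"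
    using cut Epos by (simp add: P E field_simps)
  have pos: "0 < (\<Sum>v\<in>verts G. a (r v))" by (simp add: P)
  note tight = extremal_structure[OF cut pos ext]
  show "dirichlet_path G V0"
    using cut tight(2,1) by (rule dirichlet_path_if_consecutive(1))
  show "ewt (identify G V0) x y = min_cut G"
    if "x \<in> verts (identify G V0)" "y \<in> verts (identify G V0)" "ewt (identify G V0) x y > 0" for x y
    using cut tight(2,1) that by (rule dirichlet_path_if_consecutive(2))
  show "pot G v = 0" if "v \<in> verts G - V0" for v using that by (rule tight(3))
qed

text \<open>Equality fixes more than the shape of the graph: the edges of the identified path all
  have the minimal cut weight of \<open>G\<close>, and the potential vanishes outside
  \<open>V0\<close>. The characterization therefore states these conditions explicitly.\<close>

theorem corollary5p4:
  fixes G :: "'a wgraph" and V0 :: "'a set" and p :: real and n :: nat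
  assumes "1 < p"
    and "finite_graph G"
    and "connected_graph G"
    and "V0 \<noteq> {}"
    and "V0 \<subset> verts G"
    and "n = card (verts G - V0)"
  shows "torsional_rigidity p G V0
           \<le> ereal (real n powr (p - 1) / min_cut G * total_mass G (verts G - V0) powr p) \<and>
         (p = 2 \<and> (\<forall>v\<in>verts G. vmass G v = 1) \<longrightarrow>
            torsional_rigidity 2 G V0
              \<le> ereal (real n * (real n + 1) * (2 * real n + 1) / (6 * min_cut G)) \<and>
            (torsional_rigidity 2 G V0
               = ereal (real n * (real n + 1) * (2 * real n + 1) / (6 * min_cut G))
             \<longleftrightarrow>
             dirichlet_path G V0 \<and>
             (\<forall>x\<in>verts (identify G V0). \<forall>y\<in>verts (identify G V0).
                ewt (identify G V0) x y > 0 \<longrightarrow> ewt (identify G V0) x y = min_cut G) \<and>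
             (\<forall>v\<in>verts G - V0. pot G v = 0)))"
proof -
  note G = assms(2) and V0 = assms(4,5) and n = assms(6)
  have cut: "0 < min_cut G" using assms by (intro min_cut_pos) auto
  have general: "torsional_rigidity p G V0
      \<le> ereal (real n powr (p - 1) / min_cut G * total_mass G (verts G - V0) powr p)"
  proof -
    have "torsional_rigidity p G V0
        \<le> ereal (real n powr (p - 1) * total_mass G (verts G - V0) powr p / min_cut G)"
    proof (rule torsional_rigidity_le[OF G _ cut])
      fix f :: "'a \<Rightarrow> real"
      assume "\<And>v. v \<in> V0 \<Longrightarrow> f v = 0" "\<And>v. v \<in> verts G \<Longrightarrow> 0 \<le> f v"
      then obtain r a where "ranked_function G V0 n r a" and fa: "\<And>v. v \<in> verts G \<Longrightarrow> f v = a (r v)"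
        using exists_ranked_function[where f = f, OF G V0 n] by metis
      then interpret ranked_function G V0 n r a by simp
      have "energy p G f = energy p G (\<lambda>v. a (r v))" using fa by (rule energy_cong)
      moreover have "(\<Sum>v\<in>verts G. f v * vmass G v) = (\<Sum>v\<in>verts G. a (r v) * vmass G v)"
        using fa by simp
      ultimately show "(\<Sum>v\<in>verts G. f v * vmass G v) powr p * min_cut G
          \<le> real n powr (p - 1) * total_mass G (verts G - V0) powr p * energy p G f"
        using mass_powr_le[of p "vmass G"] assms(1) cut G
        by (simp add: total_mass_def finite_graph_def less_imp_le)
    qed (use assms in auto)
    then show ?thesis by (simp add: mult_ac)
  qed
  define S where "S = (\<Sum>k<n. (real n - real k)\<^sup>2)"
  have bound: "real n * (real n + 1) * (2 * real n + 1) / (6 * min_cut G) = S / min_cut G"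
    unfolding S_def sum_squares_descending by simp
  have unit: "torsional_rigidity 2 G V0 \<le> ereal (S / min_cut G)"
    if mass: "\<forall>v\<in>verts G. vmass G v = 1"
  proof (rule torsional_rigidity_le[OF G _ cut])
    fix f :: "'a \<Rightarrow> real"
    assume "\<And>v. v \<in> V0 \<Longrightarrow> f v = 0" "\<And>v. v \<in> verts G \<Longrightarrow> 0 \<le> f v"
    then obtain r a where "ranked_function G V0 n r a" and fa: "\<And>v. v \<in> verts G \<Longrightarrow> f v = a (r v)"
      using exists_ranked_function[where f = f, OF G V0 n] by metis
    then interpret ranked_function G V0 n r a by simp
    have "energy 2 G f = energy 2 G (\<lambda>v. a (r v))" using fa by (rule energy_cong)
    moreover have "(\<Sum>v\<in>verts G. f v * vmass G v) = (\<Sum>v\<in>verts G. a (r v))"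
      using fa mass by simp
    moreover have "0 \<le> (\<Sum>v\<in>verts G. a (r v))"
      using a_nonneg rank_le by (intro sum_nonneg) auto
    ultimately show "(\<Sum>v\<in>verts G. f v * vmass G v) powr 2 * min_cut G \<le> S * energy 2 G f"
      using mass_square_le cut by (simp add: S_def)
  qed (auto simp: S_def sum_nonneg)
  have equality: "torsional_rigidity 2 G V0 = ereal (S / min_cut G) \<longleftrightarrow>
      dirichlet_path G V0 \<and>
      (\<forall>x\<in>verts (identify G V0). \<forall>y\<in>verts (identify G V0).
         ewt (identify G V0) x y > 0 \<longrightarrow> ewt (identify G V0) x y = min_cut G) \<and>
      (\<forall>v\<in>verts G - V0. pot G v = 0)" (is "?eq \<longleftrightarrow> ?path")
    if mass: "\<forall>v\<in>verts G. vmass G v = 1"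
  proof
    assume ?eq
    then have "ereal ((\<Sum>k<n. (real n - real k)\<^sup>2) / min_cut G) \<le> torsional_rigidity 2 G V0"
      by (simp add: S_def)
    from path_if_torsional_rigidity_ge[OF G V0 n _ cut this] mass show ?path by blast
  next
    assume ?path
    then have "ereal ((\<Sum>k<n. (real n - real k)\<^sup>2) / min_cut G) \<le> torsional_rigidity 2 G V0"
      using mass by (intro torsional_rigidity_path_ge[OF G V0 n _ cut]) auto
    then show ?eq using unit[OF mass] by (simp add: S_def)
  qed
  show ?thesis
    unfolding bound using general unit equality by blast
qed

end
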